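(* There is an absolute constant $C>0$ such that for all integers $n$ and $r$ with $5\leq r<n$, \[ \left|\kappa(n,r)-\mathrm{e}^{-H_r}\right|\leq C\,\frac{\nu(n,r)}{r}. \] (That is, $\kappa(n,r)=\mathrm{e}^{-H_r}+O\bigl(\nu(n,r)/r\bigr)$ uniformly in this range.)
   Context: For integers $1\leq r<n$, $\kappa(n,r)$ denotes the probability that a permutation chosen uniformly at random from the symmetric group $\mathrm{S}_n$ has no cycles of length less than $r+1$ (i.e. all its cycles have length $>r$), and $\nu(n,r)$ denotes the probability that a permutation chosen uniformly at random from $\mathrm{S}_n$ has no cycles of length greater than $r$. $H_r=\sum_{j=1}^r 1/j$ is the $r$-th harmonic number. *)

theory Defs
  imports "HOL-Probability.Probability" "HOL-Combinatorics.Orbits"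
begin

definition sym_pmf :: "nat \<Rightarrow> (nat \<Rightarrow> nat) pmf" where
  "sym_pmf n = pmf_of_set {p. p permutes {1..n}}"

(* The cycles are represented by their underlying sets, the orbits of p on {1..n};
   fixed points are cycles of length 1. *)
definition cycles_of :: "nat \<Rightarrow> (nat \<Rightarrow> nat) \<Rightarrow> nat set set" where
  "cycles_of n p = orbit p ` {1..n}"

definition kappa :: "nat \<Rightarrow> nat \<Rightarrow> real" where
  "kappa n r = measure_pmf.prob (sym_pmf n) {p. \<not> (\<exists>c\<in>cycles_of n p. card c < r + 1)}"

definition nu :: "nat \<Rightarrow> nat \<Rightarrow> real" where
  "nu n r = measure_pmf.prob (sym_pmf n) {p. \<not> (\<exists>c\<in>cycles_of n p. card c > r)}"

end

theory Submission
  imports Defs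
begin

text \<open>Let \<open>k n\<close> and \<open>v n\<close> be the probabilities that all cycles have length \<open>> r\<close>, resp. \<open>\<le> r\<close>.
  Conditioning on the length of the cycle of a fixed element gives \<open>n v n = v (n - r) + \<dots> + v (n - 1)\<close>,
  while the differences \<open>a n = k n - k (n - 1)\<close> satisfy
  \<open>n a n = - (a (n - r) + \<dots> + a (n - 1))\<close>. Hence a bound \<open>\<bar>a n\<bar> \<le> c v n\<close> that holds on a
  window of length \<open>r\<close> persists forever. On \<open>r + 2 \<le> n \<le> 2 r + 1\<close> we have \<open>k n = 1 / n\<close>, so
  \<open>\<bar>a n\<bar> \<le> 1 / r\<^sup>2\<close>, and \<open>v n \<ge> 1 / 4\<close>; thus \<open>c = 4 / r\<^sup>2\<close> works. As \<open>v\<close> is nonincreasing from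
  \<open>r\<close> on and at least halves over \<open>r\<close> steps, its tail beyond \<open>n\<close> is at most \<open>2 r v n\<close>, and so the
  distance of \<open>k n\<close> from its limit is at most \<open>8 v n / r\<close>. The limit is \<open>exp (- H)\<close>, \<open>H\<close> the
  \<open>r\<close>-th harmonic number, because \<open>\<Sum>n. a n x ^ n = exp (- (\<Sum>j=1..r. x ^ j / j))\<close>.\<close>

section \<open>Counting permutations with restricted cycle lengths\<close>

definition perms_in :: "nat set \<Rightarrow> 'a set \<Rightarrow> ('a \<Rightarrow> 'a) set" where
  "perms_in L S = {p. p permutes S \<and> (\<forall>x\<in>S. card (orbit p x) \<in> L)}"

definition full_cycles :: "'a set \<Rightarrow> ('a \<Rightarrow> 'a) set" where
  "full_cycles S = {p. p permutes S \<and> (\<forall>x\<in>S. orbit p x = S)}"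

text \<open>In a uniform permutation of \<open>Suc n\<close> points the cycle of a fixed point has
  each length \<open>Suc j\<close> with the same probability \<open>1 / Suc n\<close>, and what
  remains is uniform on \<open>n - j\<close> points.\<close>

fun cyc_prob :: "nat set \<Rightarrow> nat \<Rightarrow> real" where
  "cyc_prob L 0 = 1"
| "cyc_prob L (Suc n) = (\<Sum>j | j \<le> n \<and> Suc j \<in> L. cyc_prob L (n - j)) / real (Suc n)"

lemma finite_perms_in [simp]: "finite S \<Longrightarrow> finite (perms_in L S)"
  unfolding perms_in_def by (rule finite_subset[OF _ finite_permutations]) auto

text \<open>Each factor fixes the support of the other pointwise, so on either invariant set the
  composition agrees with one factor.\<close>

lemma orbit_comp_disjoint:
  assumes "q permutes C" "s permutes D" "C \<inter> D = {}"
  shows "x \<in> C \<Longrightarrow> orbit (q \<circ> s) x = orbit q x"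
    and "x \<in> D \<Longrightarrow> orbit (q \<circ> s) x = orbit s x"
proof -
  show "orbit (q \<circ> s) x = orbit q x" if "x \<in> C"
  proof (rule orbit_cong0[OF that])
    have *: "s y = y" if "y \<in> C" for y
      using assms that by (metis disjoint_iff permutes_not_in)
    show "q \<circ> s \<in> C \<rightarrow> C"
      using assms(1) by (auto simp: * permutes_in_image)
    show "(q \<circ> s) y = q y" if "y \<in> C" for y
      using * that by simp
  qed
  show "orbit (q \<circ> s) x = orbit s x" if "x \<in> D"
  proof (rule orbit_cong0[OF that])
    have *: "q (s y) = s y" if "y \<in> D" for y
      using assms that by (metis disjoint_iff permutes_not_in permutes_in_image)
    show "q \<circ> s \<in> D \<rightarrow> D"
      using assms(2) by (auto simp: * permutes_in_image)
    show "(q \<circ> s) y = s y" if "y \<in> D" for y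
      using * that by simp
  qed
qed

lemma perm_restrict_cyclic:
  assumes "p permutes S" "cyclic_on p C" "finite C"
  shows "perm_restrict p C permutes C"
proof (rule bij_imp_permutes)
  have inj: "inj_on (perm_restrict p C) C"
    using permutes_inj[OF assms(1)] by (auto simp: inj_on_def perm_restrict_def)
  moreover have "perm_restrict p C ` C \<subseteq> C"
    using cyclic_on_inI[OF assms(2)] by (auto simp: perm_restrict_def)
  ultimately show "bij_betw (perm_restrict p C) C C"
    using endo_inj_surj[OF assms(3)] by (auto simp: bij_betw_def)
qed (simp add: perm_restrict_def)

text \<open>Such a permutation splits uniquely into its cycle on \<open>C\<close> and a permutation
  of \<open>S - C\<close>; composition and restriction are mutually inverse. The points of
  \<open>C\<close> meet the length condition because \<open>card C\<close> is in
  \<open>L\<close>.\<close>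

lemma card_perms_in_orbit:
  assumes "finite S" "C \<subseteq> S" "a \<in> C" "card C \<in> L"
  shows "card {p \<in> perms_in L S. orbit p a = C}
       = card (full_cycles C) * card (perms_in L (S - C))"
proof -
  let ?f = "\<lambda>(q, s). q \<circ> s" and ?g = "\<lambda>p. (perm_restrict p C, perm_restrict p (S - C))"
  have disj: "C \<inter> (S - C) = {}" and un: "C \<union> (S - C) = S"
    using assms by auto
  have finC: "finite C"
    using assms finite_subset by blast
  have "bij_betw ?f (full_cycles C \<times> perms_in L (S - C)) {p \<in> perms_in L S. orbit p a = C}"
  proof (rule bij_betw_byWitness[where f' = ?g])
    show "\<forall>x\<in>full_cycles C \<times> perms_in L (S - C). ?g (?f x) = x"
    proof (rule ballI)
      fix x assume "x \<in> full_cycles C \<times> perms_in L (S - C)"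
      then obtain q s where x: "x = (q, s)" and q: "q permutes C" and s: "s permutes S - C"
        by (auto simp: full_cycles_def perms_in_def)
      have "perm_restrict (q \<circ> s) C x = q x" for x
        using permutes_not_in[OF s, of x] permutes_not_in[OF q, of x]
        by (auto simp: perm_restrict_def)
      moreover have "perm_restrict (q \<circ> s) (S - C) x = s x" for x
        using permutes_not_in[OF s, of x] permutes_not_in[OF q, of "s x"]
          permutes_in_image[OF s, of x]
        by (auto simp: perm_restrict_def)
      ultimately show "?g (?f x) = x"
        by (auto simp: x)
    qed
    have restrict: "perm_restrict p C permutes C" "perm_restrict p (S - C) permutes S - C"
        "perm_restrict p C \<circ> perm_restrict p (S - C) = p" "cyclic_on p C"
      if "p permutes S" "orbit p a = C" for p
    proof -
      show cyc: "cyclic_on p C"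
        using cyclic_on_orbit[OF that(1) assms(1), of a] that(2) by simp
      show 1: "perm_restrict p C permutes C"
        using perm_restrict_cyclic[OF that(1) cyc finC] .
      show 2: "perm_restrict p (S - C) permutes S - C"
        using perm_restrict_diff_cyclic[OF that(1) cyc] .
      show "perm_restrict p C \<circ> perm_restrict p (S - C) = p"
        using perm_restrict_union[OF 1 2 disj] un perm_restrict_id[OF that(1)] by simp
    qed
    show "\<forall>p\<in>{p \<in> perms_in L S. orbit p a = C}. ?f (?g p) = p"
      using restrict(3) by (auto simp: perms_in_def)
    show "?f ` (full_cycles C \<times> perms_in L (S - C)) \<subseteq> {p \<in> perms_in L S. orbit p a = C}"
    proof safe
      fix q s assume q: "q \<in> full_cycles C" and s: "s \<in> perms_in L (S - C)"
      then have qC: "q permutes C" and sD: "s permutes S - C"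
        by (auto simp: full_cycles_def perms_in_def)
      note orb = orbit_comp_disjoint[OF qC sD disj]
      have "q \<circ> s permutes S"
        using permutes_subset[OF qC assms(2)] permutes_subset[OF sD Diff_subset]
        by (rule permutes_compose[rotated])
      moreover have "card (orbit (q \<circ> s) x) \<in> L" if "x \<in> S" for x
        using orb[of x] q s that assms(4)
        by (cases "x \<in> C") (auto simp: full_cycles_def perms_in_def)
      ultimately show "q \<circ> s \<in> perms_in L S"
        by (auto simp: perms_in_def)
      show "x \<in> C" if "x \<in> orbit (q \<circ> s) a" for x
        using that orb(1)[OF assms(3)] q assms(3) by (auto simp: full_cycles_def)
      show "x \<in> orbit (q \<circ> s) a" if "x \<in> C" for x
        using that orb(1)[OF assms(3)] q assms(3) by (auto simp: full_cycles_def)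
    qed
    show "?g ` {p \<in> perms_in L S. orbit p a = C} \<subseteq> full_cycles C \<times> perms_in L (S - C)"
    proof (rule image_subsetI)
      fix p assume "p \<in> {p \<in> perms_in L S. orbit p a = C}"
      then have p: "p permutes S" "orbit p a = C" and L: "\<And>x. x \<in> S \<Longrightarrow> card (orbit p x) \<in> L"
        by (auto simp: perms_in_def)
      note r = restrict[OF p]
      note orb = orbit_comp_disjoint[OF r(1,2) disj, unfolded r(3)]
      have "orbit (perm_restrict p C) x = C" if "x \<in> C" for x
        using orb(1)[OF that] orbit_cyclic_eq3[OF r(4) that] by simp
      moreover have "card (orbit (perm_restrict p (S - C)) x) \<in> L" if "x \<in> S - C" for x
        using orb(2)[OF that] L that by (metis DiffD1)
      ultimately show "?g p \<in> full_cycles C \<times> perms_in L (S - C)"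
        using r by (auto simp: full_cycles_def perms_in_def)
    qed
  qed
  from bij_betw_same_card[OF this] show ?thesis
    by (simp add: card_cartesian_product)
qed

text \<open>The permutations are sorted by the cycle of \<open>a\<close>; \<open>D\<close> is that
  cycle without \<open>a\<close>, hence the length \<open>Suc (card D)\<close>.\<close>

lemma card_perms_in_insert:
  assumes "finite S" "a \<notin> S"
  shows "card (perms_in L (insert a S)) =
    (\<Sum>D | D \<subseteq> S \<and> Suc (card D) \<in> L. card (full_cycles (insert a D)) * card (perms_in L (S - D)))"
proof -
  let ?I = "{D. D \<subseteq> S \<and> Suc (card D) \<in> L}"
  let ?P = "\<lambda>D. {p \<in> perms_in L (insert a S). orbit p a = insert a D}"
  have fin: "finite ?I"
    using assms by simp
  have finD: "finite D" and notin: "a \<notin> D" if "D \<in> ?I" for D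
    using that assms finite_subset by blast+
  have "perms_in L (insert a S) = (\<Union>D\<in>?I. ?P D)"
  proof (intro equalityI subsetI)
    fix p assume p: "p \<in> perms_in L (insert a S)"
    then have perm: "p permutes insert a S" and L: "card (orbit p a) \<in> L"
      by (auto simp: perms_in_def)
    have a: "a \<in> orbit p a"
      using perm assms(1) by (intro permutation_self_in_orbit) (auto simp: permutation_permutes)
    have sub: "orbit p a \<subseteq> insert a S"
      using permutes_orbit_subset[OF perm] by simp
    have "orbit p a = insert a (orbit p a - {a})"
      using a by auto
    moreover have "Suc (card (orbit p a - {a})) = card (orbit p a)"
      using a by (meson card_Suc_Diff1 finite_orbit)
    ultimately have "orbit p a - {a} \<in> ?I" "p \<in> ?P (orbit p a - {a})"
      using sub L p by auto
    then show "p \<in> (\<Union>D\<in>?I. ?P D)"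
      by blast
  qed auto
  also have "card \<dots> = (\<Sum>D\<in>?I. card (?P D))"
    using fin assms notin by (intro card_UN_disjoint) (auto simp: insert_ident)
  also have "\<dots> = (\<Sum>D\<in>?I. card (full_cycles (insert a D)) * card (perms_in L (S - D)))"
  proof (rule sum.cong[OF refl])
    fix D assume D: "D \<in> ?I"
    have "insert a S - insert a D = S - D"
      using assms by auto
    then show "card (?P D) = card (full_cycles (insert a D)) * card (perms_in L (S - D))"
      using card_perms_in_orbit[of "insert a S" "insert a D" a L] D assms finD[OF D] notin[OF D]
      by auto
  qed
  finally show ?thesis .
qed

lemma sum_subsets_card:
  fixes f :: "nat \<Rightarrow> 'b :: comm_semiring_1"
  assumes "finite S"
  shows "(\<Sum>D | D \<subseteq> S \<and> P (card D). f (card D)) = (\<Sum>j | j \<le> card S \<and> P j. of_nat (card S choose j) * f j)"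
proof -
  let ?I = "{D. D \<subseteq> S \<and> P (card D)}" and ?J = "{j. j \<le> card S \<and> P j}"
  have "(\<Sum>D\<in>?I. f (card D)) = (\<Sum>j\<in>?J. \<Sum>D\<in>{D \<in> ?I. card D = j}. f (card D))"
    using assms by (intro sum.group[symmetric]) (auto intro: card_mono)
  also have "\<dots> = (\<Sum>j\<in>?J. of_nat (card S choose j) * f j)"
  proof (rule sum.cong[OF refl])
    fix j assume "j \<in> ?J"
    then have "{D \<in> ?I. card D = j} = {D. D \<subseteq> S \<and> card D = j}"
      by auto
    then show "(\<Sum>D\<in>{D \<in> ?I. card D = j}. f (card D)) = of_nat (card S choose j) * f j"
      using n_subsets[OF assms, of j] by simp
  qed
  finally show ?thesis .
qed

text \<open>Counting all permutations of a set by the cycle of a fixed element determines the number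
  of full cycles.\<close>
lemma card_full_cycles:
  assumes "finite S" "a \<notin> S"
  shows "card (full_cycles (insert a S)) = fact (card S)"
  using assms
proof (induction S rule: finite_psubset_induct)
  case (psubset S)
  let ?F = "\<lambda>D. card (full_cycles (insert a D)) * fact (card (S - D)) :: nat"
  have perms: "card (perms_in UNIV T) = fact (card T)" if "finite T" for T :: "'a set"
    using card_permutations[OF refl that] by (simp add: perms_in_def)
  have F: "?F D = fact (card D) * fact (card S - card D)" if "D \<in> Pow S - {S}" for D
  proof -
    have "D \<subset> S" "a \<notin> D" "finite D"
      using that psubset.prems psubset.hyps finite_subset[of D S] by auto
    then show ?thesis
      using psubset.IH[of D] psubset.hyps by (simp add: card_Diff_subset psubset_imp_subset)
  qed
  \<comment> \<open>With \<open>L = UNIV\<close> every permutation is counted, and the induction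
    hypothesis evaluates all summands except \<open>D = S\<close>.\<close>
  have "Suc (card S) * fact (card S) = card (perms_in UNIV (insert a S))"
    using perms[of "insert a S"] psubset.hyps psubset.prems by simp
  also have "\<dots> = (\<Sum>D\<in>Pow S. ?F D)"
    using card_perms_in_insert[OF psubset.hyps psubset.prems, of UNIV] psubset.hyps
    by (simp add: perms Pow_def)
  also have "\<dots> = card (full_cycles (insert a S)) + (\<Sum>D\<in>Pow S - {S}. ?F D)"
    using psubset.hyps by (subst sum.remove[of _ S]) auto
  also have "(\<Sum>D\<in>Pow S - {S}. ?F D) = (\<Sum>D\<in>Pow S - {S}. fact (card D) * fact (card S - card D))"
    using F by (intro sum.cong) auto
  finally have 1: "Suc (card S) * fact (card S) = card (full_cycles (insert a S)) + \<dots>" .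
  \<comment> \<open>The same total with the expected value in place of the unknown summand: each of
    the \<open>card S + 1\<close> sizes of \<open>D\<close> contributes
    \<open>fact (card S)\<close>.\<close>
  have "Suc (card S) * fact (card S) = (\<Sum>j\<le>card S. fact (card S))"
    by simp
  also have "\<dots> = (\<Sum>j\<le>card S. (card S choose j) * (fact j * fact (card S - j)))"
    by (intro sum.cong refl) (metis atMost_iff binomial_fact_lemma mult.commute)
  also have "\<dots> = (\<Sum>D\<in>Pow S. fact (card D) * fact (card S - card D))"
    using sum_subsets_card[OF psubset.hyps, where P = "\<lambda>_. True"
        and f = "\<lambda>j. fact j * fact (card S - j) :: nat"]
    by (simp add: Pow_def atMost_def)
  also have "\<dots> = fact (card S) + (\<Sum>D\<in>Pow S - {S}. fact (card D) * fact (card S - card D))"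
    using psubset.hyps by (subst sum.remove[of _ S]) auto
  finally show ?case
    using 1 by linarith
qed

text \<open>Induction by removing the cycle of one element: choosing its other \<open>j\<close>
  points, ordering them and permuting the rest gives
  \<open>(n choose j) * j! * (n - j)! = n!\<close>, so only the recursion of \<open>cyc_prob\<close>
  is left.\<close>

lemma card_perms_in:
  assumes "finite S"
  shows "real (card (perms_in L S)) = fact (card S) * cyc_prob L (card S)"
  using assms
proof (induction S rule: finite_psubset_induct)
  case (psubset S)
  show ?case
  proof (cases "S = {}")
    case True
    then show ?thesis
      by (simp add: perms_in_def)
  next
    case False
    then obtain a T where S: "S = insert a T" "a \<notin> T"
      by (meson Set.set_insert all_not_in_conv)
    have T: "finite T"
      using S psubset.hyps by simp
    let ?n = "card T"
    have "real (card (perms_in L S)) =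
      (\<Sum>D | D \<subseteq> T \<and> Suc (card D) \<in> L. fact (card D) * (fact (?n - card D) * cyc_prob L (?n - card D)))"
      unfolding S(1) card_perms_in_insert[OF T S(2)] of_nat_sum of_nat_mult
    proof (intro sum.cong refl arg_cong2[of _ _ _ _ "(*)"])
      fix D assume "D \<in> {D. D \<subseteq> T \<and> Suc (card D) \<in> L}"
      then have D: "D \<subseteq> T" "finite D"
        using T finite_subset by auto
      show "real (card (full_cycles (insert a D))) = fact (card D)"
        using card_full_cycles[of D a] D S by (metis of_nat_fact subset_iff)
      show "real (card (perms_in L (T - D))) = fact (?n - card D) * cyc_prob L (?n - card D)"
        using psubset.IH[of "T - D"] S D by (auto simp: card_Diff_subset)
    qed
    also have "\<dots> = (\<Sum>j | j \<le> ?n \<and> Suc j \<in> L. real (?n choose j) * (fact j * (fact (?n - j) * cyc_prob L (?n - j))))"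
      using sum_subsets_card[OF T, where P = "\<lambda>j. Suc j \<in> L"
          and f = "\<lambda>j. fact j * (fact (?n - j) * cyc_prob L (?n - j))"] by simp
    also have "\<dots> = (\<Sum>j | j \<le> ?n \<and> Suc j \<in> L. fact ?n * cyc_prob L (?n - j))"
    proof (intro sum.cong refl)
      fix j assume "j \<in> {j. j \<le> ?n \<and> Suc j \<in> L}"
      then show "real (?n choose j) * (fact j * (fact (?n - j) * cyc_prob L (?n - j)))
          = fact ?n * cyc_prob L (?n - j)"
        by (simp add: binomial_fact field_simps)
    qed
    also have "\<dots> = fact (card S) * cyc_prob L (card S)"
      using S T by (simp add: sum_distrib_left[symmetric] field_simps)
    finally show ?thesis .
  qed
qed

section \<open>From counts to probabilities\<close>

lemma prob_sym_pmf:
  assumes "\<And>p. p permutes {1..n} \<Longrightarrow> p \<in> A \<longleftrightarrow> (\<forall>x\<in>{1..n}. card (orbit p x) \<in> L)"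
  shows "measure_pmf.prob (sym_pmf n) A = cyc_prob L n"
proof -
  let ?S = "{1..n}"
  have "{p. p permutes ?S} \<noteq> {}"
    using permutes_id by blast
  then have "measure_pmf.prob (sym_pmf n) A =
      real (card ({p. p permutes ?S} \<inter> A)) / real (card {p. p permutes ?S})"
    unfolding sym_pmf_def by (intro measure_pmf_of_set finite_permutations) auto
  also have "{p. p permutes ?S} \<inter> A = perms_in L ?S"
    using assms by (auto simp: perms_in_def)
  finally show ?thesis
    using card_perms_in[of ?S L] card_permutations[of ?S n] by simp
qed

lemma kappa_eq_cyc_prob: "kappa n r = cyc_prob {r<..} n"
  unfolding kappa_def by (rule prob_sym_pmf) (auto simp: cycles_of_def not_less Suc_le_eq)

lemma nu_eq_cyc_prob: "nu n r = cyc_prob {..r} n"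
  unfolding nu_def by (rule prob_sym_pmf) (auto simp: cycles_of_def not_less)

section \<open>Recurrences for the two probabilities and for the differences\<close>

definition long_prob :: "nat \<Rightarrow> nat \<Rightarrow> real" where
  "long_prob r = cyc_prob {r<..}"

definition short_prob :: "nat \<Rightarrow> nat \<Rightarrow> real" where
  "short_prob r = cyc_prob {..r}"

lemma long_prob_0 [simp]: "long_prob r 0 = 1"
  and short_prob_0 [simp]: "short_prob r 0 = 1"
  by (simp_all add: long_prob_def short_prob_def)

lemma cyc_prob_nonneg: "cyc_prob L n \<ge> 0"
  by (induction L n rule: cyc_prob.induct) (auto intro!: sum_nonneg divide_nonneg_nonneg)

lemma short_prob_nonneg: "short_prob r n \<ge> 0"
  by (simp add: short_prob_def cyc_prob_nonneg)

text \<open>Here \<open>m\<close> is the number of points outside the cycle of a fixed element; that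
  cycle has length \<open>n - m\<close>, which exceeds \<open>r\<close> iff
  \<open>m < n - r\<close>.\<close>

lemma long_prob_rec: "real n * long_prob r n = (\<Sum>m<n - r. long_prob r m)"
proof (cases n)
  case (Suc k)
  have "real n * long_prob r n = (\<Sum>j | j \<le> k \<and> Suc j \<in> {r<..}. long_prob r (k - j))"
    by (simp add: Suc long_prob_def)
  also have "\<dots> = (\<Sum>m<n - r. long_prob r m)"
    by (rule sum.reindex_bij_witness[of _ "\<lambda>m. k - m" "\<lambda>j. k - j"]) (auto simp: Suc)
  finally show ?thesis .
qed simp

lemma short_prob_rec: "real n * short_prob r n = (\<Sum>m\<in>{n - r..<n}. short_prob r m)"
proof (cases n)
  case (Suc k)
  have "real n * short_prob r n = (\<Sum>j | j \<le> k \<and> Suc j \<in> {..r}. short_prob r (k - j))"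
    by (simp add: Suc short_prob_def)
  also have "\<dots> = (\<Sum>m\<in>{n - r..<n}. short_prob r m)"
    by (rule sum.reindex_bij_witness[of _ "\<lambda>m. k - m" "\<lambda>j. k - j"]) (auto simp: Suc)
  finally show ?thesis .
qed simp

text \<open>The value 1 at 0 treats \<open>long_prob\<close> as 0 before index 0, so that partial
  sums telescope to \<open>long_prob\<close> itself.\<close>

definition long_diff :: "nat \<Rightarrow> nat \<Rightarrow> real" where
  "long_diff r n = (if n = 0 then 1 else long_prob r n - long_prob r (n - 1))"

lemma sum_long_diff: "(\<Sum>m<n. long_diff r m) = (if n = 0 then 0 else long_prob r (n - 1))"
  by (induction n) (auto simp: long_diff_def)

text \<open>Subtracting \<open>long_prob_rec\<close> at \<open>n - 1\<close> from that at
  \<open>n\<close> leaves one value of \<open>long_prob\<close> (none if \<open>n \<le> r\<close>);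
  writing the values as partial sums of differences leaves exactly the window, with a minus
  sign.\<close>

lemma long_diff_rec:
  assumes "n > 0"
  shows "real n * long_diff r n = - (\<Sum>m\<in>{n - r..<n}. long_diff r m)"
proof -
  obtain k where n: "n = Suc k"
    using assms gr0_conv_Suc by blast
  have "{..<n} = {..<n - r} \<union> {n - r..<n}"
    by auto
  then have "(\<Sum>m<n. long_diff r m) = (\<Sum>m<n - r. long_diff r m) + (\<Sum>m\<in>{n - r..<n}. long_diff r m)"
    by (metis finite_atLeastLessThan finite_lessThan ivl_disj_int_one(2) sum.union_disjoint)
  moreover have "real n * long_diff r n = (\<Sum>m<n - r. long_prob r m) - (\<Sum>m<k - r. long_prob r m) - long_prob r k"
    using long_prob_rec[of n r] long_prob_rec[of k r] by (simp add: n long_diff_def algebra_simps)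
  moreover have "(\<Sum>m<n - r. long_prob r m) - (\<Sum>m<k - r. long_prob r m) = (\<Sum>m<n - r. long_diff r m)"
  proof (cases "r \<le> k")
    case True
    then have *: "n - r = Suc (k - r)"
      by (simp add: n Suc_diff_le)
    then have "(\<Sum>m<n - r. long_diff r m) = long_prob r (k - r)"
      by (simp only: sum_long_diff) simp
    then show ?thesis
      by (simp add: *)
  qed (simp add: n)
  moreover have "(\<Sum>m<n. long_diff r m) = long_prob r k"
    by (simp only: sum_long_diff) (simp add: n)
  ultimately show ?thesis
    by linarith
qed

section \<open>Initial values and monotonicity\<close>

lemma long_prob_eq_0: "0 < n \<Longrightarrow> n \<le> r \<Longrightarrow> long_prob r n = 0"
  using long_prob_rec[of n r] by simp

text \<open>Two cycles longer than \<open>r\<close> need \<open>2 * r + 2\<close> points, so only a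
  single full cycle is possible: in the recurrence only \<open>m = 0\<close> survives.\<close>

lemma long_prob_eq_inverse:
  assumes "r < n" "n \<le> 2 * r + 1"
  shows "long_prob r n = 1 / n"
proof -
  have "(\<Sum>m<n - r. long_prob r m) = (\<Sum>m\<in>{0}. long_prob r m)"
    using assms by (intro sum.mono_neutral_right) (auto intro: long_prob_eq_0)
  then show ?thesis
    using long_prob_rec[of n r] assms by (simp add: field_simps)
qed

text \<open>Both \<open>n\<close> and \<open>n - 1\<close> must exceed \<open>r\<close>: at
  \<open>r + 1\<close> the sequence jumps from 0 to \<open>1 / (r + 1)\<close>, which is too
  large.\<close>

lemma abs_long_diff_le:
  assumes "r > 0" "r + 2 \<le> n" "n \<le> 2 * r + 1"
  shows "\<bar>long_diff r n\<bar> \<le> 1 / real r ^ 2"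
proof -
  have "long_diff r n = 1 / real n - 1 / real (n - 1)"
    using assms long_prob_eq_inverse[of r n] long_prob_eq_inverse[of r "n - 1"]
    by (simp add: long_diff_def)
  also have "\<dots> = - (1 / (real n * real (n - 1)))"
    using assms by (simp add: field_simps of_nat_diff)
  finally have "\<bar>long_diff r n\<bar> = 1 / (real n * real (n - 1))"
    by simp
  also have "\<dots> \<le> 1 / (real r * real r)"
    using assms by (intro divide_left_mono mult_mono mult_pos_pos) auto
  finally show ?thesis
    by (simp add: power2_eq_square)
qed

lemma short_prob_eq_1: "n \<le> r \<Longrightarrow> short_prob r n = 1"
proof (induction n rule: less_induct)
  case (less n)
  then have "(\<Sum>m\<in>{n - r..<n}. short_prob r m) = real n"
    by simp
  then show ?case
    using short_prob_rec[of n r] by (cases "n = 0") auto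
qed

text \<open>The windows in the recurrences at \<open>n\<close> and \<open>Suc n\<close> differ only
  at their end points.\<close>

lemma short_prob_Suc:
  assumes "r \<le> n"
  shows "short_prob r (Suc n) = short_prob r n - short_prob r (n - r) / Suc n"
proof -
  have "(\<Sum>m\<in>{n - r..<Suc n}. short_prob r m) = short_prob r (n - r) + (\<Sum>m\<in>{Suc n - r..<Suc n}. short_prob r m)"
    using assms by (subst sum.atLeast_Suc_lessThan) (auto simp: Suc_diff_le)
  moreover have "(\<Sum>m\<in>{n - r..<Suc n}. short_prob r m) = (\<Sum>m\<in>{n - r..<n}. short_prob r m) + short_prob r n"
    by (subst sum.atLeastLessThan_Suc) auto
  ultimately have "real (Suc n) * short_prob r (Suc n) = real (Suc n) * short_prob r n - short_prob r (n - r)"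
    using short_prob_rec[of n r] short_prob_rec[of "Suc n" r] by (simp add: algebra_simps)
  then show ?thesis
    by (simp add: field_simps del: of_nat_Suc)
qed

lemma short_prob_antimono:
  assumes "r \<le> m" "m \<le> n"
  shows "short_prob r n \<le> short_prob r m"
  using assms(2)
proof (induction n rule: dec_induct)
  case (step n)
  then show ?case
    using short_prob_Suc[of r n] short_prob_nonneg[of r "n - r"] assms(1)
    by (smt (verit) divide_nonneg_nonneg le_trans of_nat_0_le_iff)
qed simp

lemma short_prob_ge:
  assumes "5 \<le> r" "n \<le> 2 * r + 1"
  shows "short_prob r n \<ge> 1 / 4"
proof -
  \<comment> \<open>Up to this range the term subtracted in \<open>short_prob_Suc\<close> has
    numerator 1, as its index is at most \<open>r\<close>.\<close>
  have eq: "short_prob r (r + i) = 1 - (\<Sum>j<i. 1 / real (Suc (r + j)))" if "i \<le> Suc r" for i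
    using that
  proof (induction i)
    case (Suc i)
    then show ?case
      using short_prob_Suc[of r "r + i"] by (simp add: short_prob_eq_1)
  qed (simp add: short_prob_eq_1)
  \<comment> \<open>The sum decreases in \<open>r\<close>: the next one drops
    \<open>1 / (r + 1)\<close> and gains two terms of at most \<open>1 / (2 * r + 2)\<close> each.
    For \<open>r = 5\<close> it is 1/6 + ... + 1/11 < 0.737.\<close>
  have sum_le: "(\<Sum>j<Suc r. 1 / real (Suc (r + j))) \<le> 3 / 4"
    using assms(1)
  proof (induction r rule: dec_induct)
    case base
    show ?case
      by (simp add: eval_nat_numeral)
  next
    case (step r)
    have "(\<Sum>j<Suc (Suc r). 1 / real (Suc (Suc r + j)))
        = (\<Sum>j<Suc (Suc (Suc r)). 1 / real (Suc (r + j))) - 1 / real (Suc r)"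
      by (subst (2) sum.lessThan_Suc_shift) simp
    also have "\<dots> = (\<Sum>j<Suc r. 1 / real (Suc (r + j))) + 1 / real (2 * r + 2) + 1 / real (2 * r + 3) - 1 / real (Suc r)"
      by (simp add: algebra_simps)
    also have "\<dots> \<le> 3 / 4"
    proof -
      have "1 / real (2 * r + 3) \<le> 1 / real (2 * r + 2)"
        by (intro divide_left_mono) auto
      moreover have "1 / real (Suc r) = 2 / real (2 * r + 2)"
        by (simp add: field_simps)
      ultimately show ?thesis
        using step.IH by linarith
    qed
    finally show ?case .
  qed
  have "2 * r + 1 = r + Suc r"
    by simp
  then have "short_prob r (2 * r + 1) \<ge> 1 / 4"
    using eq[OF order_refl] sum_le by (simp only:)
  then show ?thesis
    using short_prob_antimono[of r n "2 * r + 1"] short_prob_eq_1[of n r] assms(2)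
    by (cases "r \<le> n") auto
qed

section \<open>Comparison of the differences with \<open>short_prob\<close>, and the tail
  bound\<close>

lemma abs_long_diff_le_short_prob:
  assumes "5 \<le> r" "r + 2 \<le> n"
  shows "\<bar>long_diff r n\<bar> \<le> 4 / real r ^ 2 * short_prob r n"
  using assms(2)
proof (induction n rule: less_induct)
  case (less n)
  show ?case
  proof (cases "n \<le> 2 * r + 1")
    case True
    have "1 / real r ^ 2 \<le> 4 / real r ^ 2 * short_prob r n"
      using short_prob_ge[OF assms(1) True] assms(1) by (simp add: field_simps)
    then show ?thesis
      using abs_long_diff_le[of r n] assms(1) less.prems True by linarith
  next
    case False
    have "real n * \<bar>long_diff r n\<bar> = \<bar>\<Sum>m\<in>{n - r..<n}. long_diff r m\<bar>"
      using long_diff_rec[of n r] less.prems by (simp add: abs_mult[of "real n", simplified, symmetric])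
    \<comment> \<open>Since \<open>n \<ge> 2 * r + 2\<close>, the window starts at
      \<open>r + 2\<close> or later, where the induction hypothesis applies.\<close>
    also have "\<dots> \<le> (\<Sum>m\<in>{n - r..<n}. 4 / real r ^ 2 * short_prob r m)"
      using less.IH False by (intro order_trans[OF sum_abs] sum_mono) auto
    also have "\<dots> = 4 / real r ^ 2 * (\<Sum>m\<in>{n - r..<n}. short_prob r m)"
      by (rule sum_distrib_left[symmetric])
    also have "\<dots> = real n * (4 / real r ^ 2 * short_prob r n)"
      by (subst short_prob_rec[symmetric]) simp
    finally show ?thesis
      by (rule mult_left_le_imp_le) (use less.prems in simp)
  qed
qed

lemma sum_short_prob_le:
  assumes "r \<le> n"
  shows "(\<Sum>m\<in>{n<..n + k}. short_prob r m) \<le> 2 * real r * short_prob r n"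
proof -
  \<comment> \<open>Twice the sum of the values over a window of length \<open>r\<close> decreases fast enough
    to absorb the next value, since \<open>short_prob r (m + r) \<le> short_prob r m / 2\<close>.\<close>
  define W where "W m = real (m + r) * short_prob r (m + r)" for m
  have W: "W m = (\<Sum>i\<in>{m..<m + r}. short_prob r i)" for m
    unfolding W_def by (subst short_prob_rec) simp
  have W_le: "W m \<le> real r * short_prob r m" if "r \<le> m" for m
  proof -
    have "W m \<le> (\<Sum>i\<in>{m..<m + r}. short_prob r m)"
      unfolding W using that by (intro sum_mono short_prob_antimono) auto
    then show ?thesis
      by simp
  qed
  have step: "short_prob r (Suc m) \<le> 2 * W m - 2 * W (Suc m)" if "r \<le> m" for m
  proof (cases "r = 0")
    case True
    then show ?thesis
      using short_prob_rec[of "Suc m" r] by (simp add: W)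
  next
    case False
    have "W m + short_prob r (m + r) = (\<Sum>i\<in>{m..<Suc (m + r)}. short_prob r i)"
      by (simp add: W)
    also have "\<dots> = short_prob r m + W (Suc m)"
      by (subst sum.atLeast_Suc_lessThan) (auto simp: W)
    finally have "W m - W (Suc m) = short_prob r m - short_prob r (m + r)"
      by simp
    \<comment> \<open>The halving comes from \<open>m + r \<ge> 2 * r\<close>. It gives
      \<open>W m - W (Suc m) \<ge> short_prob r m / 2\<close>, which pays for the next
      value.\<close>
    moreover have "2 * real r * short_prob r (m + r) \<le> real (m + r) * short_prob r (m + r)"
      using that short_prob_nonneg by (intro mult_right_mono) auto
    then have "real r * (2 * short_prob r (m + r)) \<le> real r * short_prob r m"
      using W_le[OF that] by (simp add: W_def)
    then have "2 * short_prob r (m + r) \<le> short_prob r m"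
      using False by simp
    ultimately show ?thesis
      using short_prob_antimono[of r m "Suc m"] that by simp
  qed
  have "(\<Sum>m\<in>{n<..n + k}. short_prob r m) \<le> 2 * W n - 2 * W (n + k)"
  proof (induction k)
    case (Suc k)
    have "{n<..n + Suc k} = insert (Suc (n + k)) {n<..n + k}"
      by auto
    then show ?case
      using Suc step[of "n + k"] assms by simp
  qed simp
  also have "\<dots> \<le> 2 * W n"
    by (simp add: W_def short_prob_nonneg)
  also have "\<dots> \<le> 2 * (real r * short_prob r n)"
    using W_le[OF assms] by simp
  finally show ?thesis
    by simp
qed

text \<open>The bound is uniform in \<open>k\<close>, so it survives the passage to the limit. Its 8
  is the 4 from \<open>short_prob \<ge> 1 / 4\<close> times the 2 from the tail sum.\<close>

lemma long_prob_diff_le: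
  assumes "5 \<le> r" "r < n"
  shows "\<bar>long_prob r (n + k) - long_prob r n\<bar> \<le> 8 * (short_prob r n / real r)"
proof -
  have "long_prob r (n + k) - long_prob r n = (\<Sum>m\<in>{n<..n + k}. long_diff r m)"
  proof (induction k)
    case (Suc k)
    have "{n<..n + Suc k} = insert (Suc (n + k)) {n<..n + k}"
      by auto
    then show ?case
      using Suc by (simp add: long_diff_def)
  qed simp
  also have "\<bar>\<dots>\<bar> \<le> (\<Sum>m\<in>{n<..n + k}. 4 / real r ^ 2 * short_prob r m)"
    using assms by (intro order_trans[OF sum_abs] sum_mono abs_long_diff_le_short_prob) auto
  also have "\<dots> = 4 / real r ^ 2 * (\<Sum>m\<in>{n<..n + k}. short_prob r m)"
    by (simp add: sum_distrib_left)
  also have "\<dots> \<le> 4 / real r ^ 2 * (2 * real r * short_prob r n)"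
    using assms by (intro mult_left_mono sum_short_prob_le) auto
  also have "\<dots> = 8 * (short_prob r n / real r)"
    using assms by (simp add: field_simps power2_eq_square)
  finally show ?thesis .
qed

section \<open>Generating function of the differences and the limit\<close>

text \<open>This makes the power series converge everywhere. Once \<open>n \<ge> r * M ^ r\<close>,
  the division by \<open>n\<close> in the recurrence outweighs \<open>r\<close> terms, each scaled
  by at most \<open>M ^ r\<close>; the finitely many earlier terms are bounded by their sum.\<close>

lemma long_diff_power_bounded:
  fixes M :: real
  assumes "M \<ge> 1"
  obtains B where "B \<ge> 0" "\<And>n. \<bar>long_diff r n\<bar> * M ^ n \<le> B"
proof -
  define b where "b n = \<bar>long_diff r n\<bar> * M ^ n" for n
  define N where "N = nat \<lceil>real r * M ^ r\<rceil>"
  define B where "B = (\<Sum>n\<le>N. b n)"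
  have b_nonneg: "b n \<ge> 0" for n
    using assms by (simp add: b_def)
  have "b n \<le> B" for n
  proof (induction n rule: less_induct)
    case (less n)
    show ?case
    proof (cases "n \<le> N")
      case True
      then show ?thesis
        unfolding B_def using b_nonneg by (intro member_le_sum) auto
    next
      case False
      then have n: "n > 0" "real n \<ge> real r * M ^ r"
        unfolding N_def by linarith+
      have B: "B \<ge> 0"
        unfolding B_def by (intro sum_nonneg b_nonneg)
      have "real n * b n = \<bar>real n * long_diff r n\<bar> * M ^ n"
        by (simp add: b_def abs_mult)
      also have "\<dots> = \<bar>\<Sum>m\<in>{n - r..<n}. long_diff r m\<bar> * M ^ n"
        using long_diff_rec[OF n(1), of r] by simp
      also have "\<dots> \<le> (\<Sum>m\<in>{n - r..<n}. \<bar>long_diff r m\<bar>) * M ^ n"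
        using assms by (intro mult_right_mono sum_abs) auto
      also have "\<dots> = (\<Sum>m\<in>{n - r..<n}. \<bar>long_diff r m\<bar> * M ^ n)"
        by (simp add: sum_distrib_right)
      also have "\<dots> \<le> (\<Sum>m\<in>{n - r..<n}. M ^ r * B)"
      proof (rule sum_mono)
        fix m assume m: "m \<in> {n - r..<n}"
        have "\<bar>long_diff r m\<bar> * M ^ n \<le> \<bar>long_diff r m\<bar> * M ^ (r + m)"
          using m assms by (intro mult_left_mono power_increasing) auto
        also have "\<dots> = M ^ r * b m"
          by (simp add: b_def power_add)
        also have "\<dots> \<le> M ^ r * B"
          using less.IH[of m] m assms by (intro mult_left_mono) auto
        finally show "\<bar>long_diff r m\<bar> * M ^ n \<le> M ^ r * B" .
      qed
      also have "\<dots> = real (n - (n - r)) * (M ^ r * B)"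
        by simp
      also have "\<dots> \<le> real r * (M ^ r * B)"
        using assms B by (intro mult_right_mono) auto
      also have "\<dots> = (real r * M ^ r) * B"
        by simp
      also have "\<dots> \<le> real n * B"
        using n B by (intro mult_right_mono)
      finally show ?thesis
        using n by simp
    qed
  qed
  moreover have "B \<ge> 0"
    unfolding B_def by (intro sum_nonneg b_nonneg)
  ultimately show ?thesis
    using that unfolding b_def by blast
qed

lemma summable_long_diff: "summable (\<lambda>n. long_diff r n * x ^ n)" for x :: real
proof -
  \<comment> \<open>Any \<open>M > \<bar>x\<bar>\<close> with \<open>M \<ge> 1\<close> gives a
    geometric majorant of ratio \<open>\<bar>x\<bar> / M < 1\<close>.\<close>
  define M where "M = \<bar>x\<bar> + 1"
  have M: "M \<ge> 1"
    by (simp add: M_def)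
  obtain B where B: "B \<ge> 0" "\<And>n. \<bar>long_diff r n\<bar> * M ^ n \<le> B"
    using long_diff_power_bounded[OF M, of r] by blast
  have "norm (long_diff r n * x ^ n) \<le> B * (\<bar>x\<bar> / M) ^ n" for n
  proof -
    have "norm (long_diff r n * x ^ n) = (\<bar>long_diff r n\<bar> * M ^ n) * (\<bar>x\<bar> / M) ^ n"
      using M by (simp add: abs_mult power_abs power_divide)
    also have "\<dots> \<le> B * (\<bar>x\<bar> / M) ^ n"
      using B M by (intro mult_right_mono) auto
    finally show ?thesis .
  qed
  moreover have "summable (\<lambda>n. B * (\<bar>x\<bar> / M) ^ n)"
    by (intro summable_mult summable_geometric) (simp add: M_def)
  ultimately show ?thesis
    by (rule summable_comparison_test'[rotated])
qed

text \<open>The power series \<open>f\<close> with coefficients \<open>long_diff r n\<close> is \<open>exp (- (\<Sum>j=1..r. x ^ j / j))\<close>: the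
  recurrence for the coefficients says that \<open>f' = - (\<Sum>j<r. x ^ j) * f\<close>.\<close>
lemma long_diff_sums_exp: "long_diff r sums exp (- harm r)"
proof -
  define f where "f x = (\<Sum>n. long_diff r n * x ^ n)" for x :: real
  define P where "P x = (\<Sum>j<r. x ^ Suc j / real (Suc j))" for x :: real
  have sums_f: "(\<lambda>n. long_diff r n * x ^ n) sums f x" for x
    unfolding f_def using summable_long_diff by (rule summable_sums)
  have diffs: "(\<lambda>n. diffs (long_diff r) n * x ^ n) sums (- (\<Sum>j<r. x ^ j) * f x)" for x
  proof -
    \<comment> \<open>\<open>c j\<close> lists the terms of \<open>x ^ j * f x\<close>:
      multiplication by \<open>x ^ j\<close> shifts the coefficients by \<open>j\<close>, and
      summing over \<open>j < r\<close> collects the window of the recurrence at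
      \<open>Suc n\<close>.\<close>
    define c where "c j n = (if n < j then 0 else long_diff r (n - j) * x ^ n)" for j n
    have "c j sums (x ^ j * f x)" for j
    proof -
      have "(\<lambda>n. c j (n + j)) sums (x ^ j * f x)"
        using sums_mult[OF sums_f, of "x ^ j" x] by (simp add: c_def power_add mult_ac)
      then show ?thesis
        by (subst (asm) sums_zero_iff_shift) (auto simp: c_def)
    qed
    then have "(\<lambda>n. - (\<Sum>j<r. c j n)) sums (- (\<Sum>j<r. x ^ j * f x))"
      by (intro sums_minus sums_sum)
    moreover have "- (\<Sum>j<r. c j n) = diffs (long_diff r) n * x ^ n" for n
    proof -
      have "(\<Sum>j<r. c j n) = (\<Sum>j | j < r \<and> j \<le> n. long_diff r (n - j) * x ^ n)"
        by (intro sum.mono_neutral_cong_right) (auto simp: c_def)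
      also have "\<dots> = (\<Sum>m\<in>{Suc n - r..<Suc n}. long_diff r m * x ^ n)"
        by (rule sum.reindex_bij_witness[of _ "\<lambda>m. n - m" "\<lambda>j. n - j"]) auto
      also have "\<dots> = (\<Sum>m\<in>{Suc n - r..<Suc n}. long_diff r m) * x ^ n"
        by (simp only: sum_distrib_right)
      also have "\<dots> = - (diffs (long_diff r) n * x ^ n)"
        using long_diff_rec[of "Suc n" r] by (simp add: diffs_def)
      finally show ?thesis
        by simp
    qed
    ultimately show ?thesis
      by (simp add: sum_distrib_right)
  qed
  have f': "(f has_real_derivative - (\<Sum>j<r. x ^ j) * f x) (at x)" for x
    using termdiffs_strong_converges_everywhere[OF summable_long_diff, of r x] sums_unique[OF diffs, of x]
    unfolding f_def[abs_def] by simp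
  have P': "(P has_real_derivative (\<Sum>j<r. x ^ j)) (at x)" for x
    unfolding P_def[abs_def] by (auto intro!: derivative_eq_intros sum.cong simp del: of_nat_Suc power_Suc)
  \<comment> \<open>With the integrating factor \<open>exp (P x)\<close> the solution is constant;
    comparing 0 and 1 then yields the sum of all coefficients.\<close>
  have "((\<lambda>x. f x * exp (P x)) has_real_derivative 0) (at x)" for x
    by (rule derivative_eq_intros f' P' refl | simp add: algebra_simps)+
  then have "f 1 * exp (P 1) = f 0 * exp (P 0)"
    using DERIV_isconst_all by blast
  moreover have "f 0 = 1"
    using sums_unique[OF sums_f[of 0]] powser_zero[of "long_diff r"] by (simp add: f_def long_diff_def)
  moreover have "P 1 = harm r"
    unfolding P_def harm_def by (rule sum.reindex_bij_witness[of _ "\<lambda>j. j - 1" Suc]) (auto simp: field_simps)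
  moreover have "P 0 = 0"
    by (simp add: P_def)
  ultimately have "f 1 = exp (- harm r)"
    by (simp add: exp_minus field_simps)
  then show ?thesis
    using sums_f[of 1] by simp
qed

lemma long_prob_tendsto: "long_prob r \<longlonglongrightarrow> exp (- harm r)"
proof -
  have "(\<lambda>n. \<Sum>m<Suc n. long_diff r m) \<longlonglongrightarrow> exp (- harm r)"
    using long_diff_sums_exp[of r] unfolding sums_def by (rule LIMSEQ_Suc)
  then show ?thesis
    by (simp only: sum_long_diff) simp
qed

theorem theorem3:
  shows "\<exists>C::real. C > 0 \<and> (\<forall>n r :: nat. 5 \<le> r \<and> r < n \<longrightarrow>
           \<bar>kappa n r - exp (- harm r)\<bar> \<le> C * (nu n r / real r))"
proof (intro exI[of _ 8] conjI allI impI)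
  fix n r :: nat assume *: "5 \<le> r \<and> r < n"
  \<comment> \<open>For fixed \<open>n\<close>, let \<open>k\<close> tend to infinity.\<close>
  have "(\<lambda>k. \<bar>long_prob r (n + k) - long_prob r n\<bar>) \<longlonglongrightarrow> \<bar>exp (- harm r) - long_prob r n\<bar>"
    using LIMSEQ_ignore_initial_segment[OF long_prob_tendsto[of r], of n]
    by (intro tendsto_intros) (simp add: add.commute)
  then have "\<bar>exp (- harm r) - long_prob r n\<bar> \<le> 8 * (short_prob r n / real r)"
    by (rule LIMSEQ_le_const2) (use * long_prob_diff_le in blast)
  then show "\<bar>kappa n r - exp (- harm r)\<bar> \<le> 8 * (nu n r / real r)"
    by (simp add: kappa_eq_cyc_prob nu_eq_cyc_prob long_prob_def short_prob_def abs_minus_commute)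
qed simp

end
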